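(* Let $\beta<1$ be a real number. Then the Tsallis entropy $$H_\beta^T(p_1,\dots,p_n)=\frac{1}{\beta-1}\Big(1-\sum_{i=1}^n p_i^\beta\Big),\qquad (p_1,\dots,p_n)\in\Omega_n,\ n\ge1,$$ satisfies the lower entropy axioms, i.e. it is a lower entropy function.
   Context: For each integer $N\ge 1$ let $\Omega_N=\{(p_1,\dots,p_N): p_i\ge 0,\ \sum_{i=1}^N p_i=1\}$, and let $\Omega=\bigcup_{N\ge1}\Omega_N$. The Tsallis entropy is defined by the displayed formula for every real $\beta\neq 1$. A function $H:\Omega\to\mathbb{R}$ is called a lower entropy function if it satisfies the following four axioms (the lower entropy axioms): (i) Continuity: $H(p_1,\dots,p_N)$ is a continuous function (on each $\Omega_N$), and $H(p_1,\dots,p_N)=0$ if and only if there is $k$ with $p_k=1$. (ii) Symmetric expansibility: $H(p_1,\dots,p_N)$ is invariant under permutations of its arguments, and $H(p_1,\dots,p_{n-1},p_n,\dots,p_N)=H(p_1,\dots,p_{n-1},0,p_n,\dots,p_N)$ for all $(p_1,\dots,p_N)\in\Omega_N$ and $1\le n\le N$. (iii) Increasing property: if $(p_1,\dots,p_N)\in\Omega_N$, $1\le n\le N$, $m\ge1$, $q_1,\dots,q_m\ge 0$ and $p_n=\sum_{i=1}^m q_i$, then $$H(p_1,\dots,p_{n-1},q_1,\dots,q_m,p_{n+1},\dots,p_N)-H(p_1,\dots,p_N)\ge p_n H\Big(\frac{q_1}{p_n},\dots,\frac{q_m}{p_n}\Big),$$ where the right-hand side is read as $0$ when $p_n=0$.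 (iv) Maximum: for every integer $N\ge1$ and $(p_1,\dots,p_N)\in\Omega_N$, $H(p_1,\dots,p_N)\le H(\frac1N,\dots,\frac1N)$.
   Formalization: The formal statement assumes 0 < β < 1 instead of β < 1: for β < 0 the maximum axiom fails (β = −1: H(1/10,9/10) > H(1/2,1/2)), and for β = 0 no value of 0^0 satisfies axiom (i), since H = 1 on the interior of Ω_2 but H(1,0) must be 0. *)

theory Defs
  imports "HOL-Analysis.Analysis" "HOL-Combinatorics.Permutations"
begin

definition Omega_N :: "nat \<Rightarrow> real list set" where
  "Omega_N N = {p. length p = N \<and> (\<forall>x\<in>set p. 0 \<le> x) \<and> sum_list p = 1}"

definition Omega :: "real list set" where
  "Omega = (\<Union>N\<in>{1..}. Omega_N N)"

(* An entropy is a total function on real lists of which only the values on Omega matter.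
   Lists carry no topology, so a point of R^N is given by the first N coordinates of a
   sequence, and nat => real has the product topology. The function below ignores the
   remaining coordinates, so this is ordinary continuity on the simplex in R^N. *)
definition entropy_continuity :: "(real list \<Rightarrow> real) \<Rightarrow> bool" where
  "entropy_continuity H \<longleftrightarrow>
     (\<forall>N\<ge>1. continuous_on {x :: nat \<Rightarrow> real. map x [0..<N] \<in> Omega_N N}
               (\<lambda>x. H (map x [0..<N]))) \<and>
     (\<forall>p\<in>Omega. H p = 0 \<longleftrightarrow> (\<exists>k<length p. p ! k = 1))"

definition symmetric_expansibility :: "(real list \<Rightarrow> real) \<Rightarrow> bool" where
  "symmetric_expansibility H \<longleftrightarrow>
     (\<forall>p\<in>Omega. \<forall>\<sigma>. \<sigma> permutes {..<length p} \<longrightarrow> H (permute_list \<sigma> p) = H p) \<and>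
     (\<forall>xs pn ys. xs @ pn # ys \<in> Omega \<longrightarrow> H (xs @ pn # ys) = H (xs @ 0 # pn # ys))"

definition increasing_property :: "(real list \<Rightarrow> real) \<Rightarrow> bool" where
  "increasing_property H \<longleftrightarrow>
     (\<forall>xs pn ys qs. xs @ pn # ys \<in> Omega \<longrightarrow> qs \<noteq> [] \<longrightarrow> (\<forall>q\<in>set qs. 0 \<le> q) \<longrightarrow>
        pn = sum_list qs \<longrightarrow>
        H (xs @ qs @ ys) - H (xs @ pn # ys)
          \<ge> (if pn = 0 then 0 else pn * H (map (\<lambda>q. q / pn) qs)))"

definition maximum_property :: "(real list \<Rightarrow> real) \<Rightarrow> bool" where
  "maximum_property H \<longleftrightarrow>
     (\<forall>N\<ge>1. \<forall>p\<in>Omega_N N. H p \<le> H (replicate N (1 / real N)))"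

definition lower_entropy :: "(real list \<Rightarrow> real) \<Rightarrow> bool" where
  "lower_entropy H \<longleftrightarrow>
     entropy_continuity H \<and> symmetric_expansibility H \<and>
     increasing_property H \<and> maximum_property H"

(* Pitfall: 0 powr b = 0 for every b. This is the usual value only for b > 0; for b <= 0
   the formula has no agreed real value at a distribution with a zero entry, and no choice
   of that value yields a lower entropy function. *)
definition tsallis :: "real \<Rightarrow> real list \<Rightarrow> real" where
  "tsallis \<beta> p = 1 / (\<beta> - 1) * (1 - (\<Sum>x\<leftarrow>p. x powr \<beta>))"

end

theory Submission
  imports Defs
begin

text \<open>
  Write \<open>S p\<close> for the sum of the powers \<open>x powr \<beta>\<close> of the entries, so that the entropy is
  \<open>(S p - 1) / (1 - \<beta>)\<close> with a positive denominator. Symmetry and expansibility are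
  visible in this form (an added entry 0 contributes \<open>0 powr \<beta> = 0\<close>), and continuity up to the
  boundary of the simplex is where \<open>\<beta> > 0\<close> enters. The rest follows from two properties of
  \<open>x powr \<beta>\<close> for \<open>0 < \<beta> < 1\<close>. On the unit interval its graph lies above the diagonal and meets it
  only at the endpoints; hence \<open>S p \<ge> 1\<close> on distributions, with equality only at the vertices of
  the simplex, which is the zero condition (\<open>sum_powr_eq_1_iff\<close>). Homogeneity turns the same fact
  into subadditivity (\<open>powr_sum_list_le\<close>). When an entry \<open>p\<close> is refined into \<open>qs\<close>, the two sides
  of the increasing property are \<open>S qs - p powr \<beta>\<close> and \<open>p powr (1 - \<beta>)\<close> times that difference,
  up to the common factor \<open>1 / (1 - \<beta>)\<close>; the difference is nonnegative by subadditivity and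
  \<open>p \<le> 1\<close>. The second property is concavity: the graph lies below its tangent at \<open>1 / N\<close>,
  and the deviations from \<open>1 / N\<close> cancel upon summation because the entries have mean \<open>1 / N\<close>,
  which gives the maximum (\<open>powr_le_tangent\<close>, \<open>sum_powr_le_uniform\<close>).
\<close>

lemma le_powr_unit:
  fixes x \<beta> :: real
  assumes "0 \<le> x" "x \<le> 1" "\<beta> \<le> 1"
  shows "x \<le> x powr \<beta>"
  using powr_mono'[of \<beta> 1 x] assms by simp

lemma powr_fixed_point:
  fixes x \<beta> :: real
  assumes "0 \<le> x" "\<beta> \<noteq> 1" "x powr \<beta> = x"
  shows "x = 0 \<or> x = 1"
proof (rule ccontr)
  assume "\<not> (x = 0 \<or> x = 1)"
  then have "x > 0" "x \<noteq> 1" using assms by auto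
  then have "\<beta> * ln x = ln x" "ln x \<noteq> 0" using assms(3) ln_powr[of x \<beta>] by auto
  then show False using assms(2) by simp
qed

lemma member_le_sum_list_real:
  fixes qs :: "real list"
  assumes "\<forall>q\<in>set qs. 0 \<le> q" "q \<in> set qs"
  shows "q \<le> sum_list qs"
proof -
  obtain xs ys where eq: "qs = xs @ q # ys" using assms(2) by (auto simp: in_set_conv_decomp)
  have "0 \<le> sum_list xs" "0 \<le> sum_list ys" using assms(1) eq by (auto intro!: sum_list_nonneg)
  then show ?thesis using eq by simp
qed

text \<open>Dividing by the total brings the entries into the unit interval, where the power dominates
  the identity.\<close>

lemma powr_sum_list_le:
  fixes qs :: "real list"
  assumes nonneg: "\<forall>q\<in>set qs. 0 \<le> q" and "\<beta> \<le> 1"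
  shows "sum_list qs powr \<beta> \<le> (\<Sum>q\<leftarrow>qs. q powr \<beta>)"
proof (cases "sum_list qs = 0")
  case True
  have "0 \<le> (\<Sum>q\<leftarrow>qs. q powr \<beta>)" by (intro sum_list_nonneg) auto
  then show ?thesis using True by simp
next
  case False
  define s where "s = sum_list qs"
  have s: "0 < s" using False sum_list_nonneg[of qs] nonneg by (simp add: s_def less_le)
  have step: "s powr \<beta> / s * q \<le> q powr \<beta>" if "q \<in> set qs" for q
  proof -
    have q: "0 \<le> q" "q \<le> s" using that nonneg member_le_sum_list_real s_def by auto
    then have "q / s \<le> (q / s) powr \<beta>" using s \<open>\<beta> \<le> 1\<close> by (intro le_powr_unit) auto
    then have "s powr \<beta> * (q / s) \<le> s powr \<beta> * (q powr \<beta> / s powr \<beta>)"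
      using q s by (intro mult_left_mono) (auto simp: powr_divide)
    then show ?thesis using s by simp
  qed
  have "s powr \<beta> = (\<Sum>q\<leftarrow>qs. s powr \<beta> / s * q)"
    using s by (subst sum_list_const_mult) (simp add: s_def)
  also have "\<dots> \<le> (\<Sum>q\<leftarrow>qs. q powr \<beta>)"
    using step by (intro sum_list_mono)
  finally show ?thesis by (simp add: s_def)
qed

text \<open>Since the entries sum to 1, equality makes the sum of the nonnegative gaps \<open>x powr \<beta> - x\<close>
  vanish, so every entry is a fixed point of the power. The convention \<open>0 powr \<beta> = 0\<close> makes 0 a
  fixed point for exponents of either sign.\<close>

lemma sum_powr_eq_1_iff:
  fixes p :: "real list"
  assumes nonneg: "\<forall>x\<in>set p. 0 \<le> x" and sum: "sum_list p = 1" and "\<beta> < 1"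
  shows "(\<Sum>x\<leftarrow>p. x powr \<beta>) = 1 \<longleftrightarrow> 1 \<in> set p"
proof
  assume eq: "(\<Sum>x\<leftarrow>p. x powr \<beta>) = 1"
  have ge: "0 \<le> x powr \<beta> - x" if "x \<in> set p" for x
    using le_powr_unit[of x \<beta>] member_le_sum_list_real[of p x] that assms by auto
  have "(\<Sum>x\<leftarrow>p. x powr \<beta> - x) = 0"
    using eq sum by (simp add: sum_list_subtractf)
  then have "\<forall>x\<in>set p. x powr \<beta> - x = 0"
    using ge by (subst (asm) sum_list_nonneg_eq_0_iff) auto
  then have "\<forall>x\<in>set p. x = 0 \<or> x = 1"
    using powr_fixed_point[of _ \<beta>] nonneg \<open>\<beta> < 1\<close> by auto
  moreover have "\<not> (\<forall>x\<in>set p. x = 0)"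
    using sum sum_list_nonneg_eq_0_iff[of p] nonneg by auto
  ultimately show "1 \<in> set p" by auto
next
  assume "1 \<in> set p"
  then obtain xs ys where eq: "p = xs @ 1 # ys" by (auto simp: in_set_conv_decomp)
  have "sum_list (xs @ ys) = 0" using sum eq by simp
  then have "\<forall>x\<in>set (xs @ ys). x = 0"
    using nonneg eq by (subst (asm) sum_list_nonneg_eq_0_iff) auto
  then have "\<forall>x\<in>set (xs @ ys). x powr \<beta> = 0" by simp
  then have "(\<Sum>x\<leftarrow>xs @ ys. x powr \<beta>) = (\<Sum>x\<leftarrow>xs @ ys. 0)"
    by (intro arg_cong[of _ _ sum_list] map_cong) auto
  then show "(\<Sum>x\<leftarrow>p. x powr \<beta>) = 1" by (simp add: eq)
qed

text \<open>The tangent at 1 is the inequality of weighted means for \<open>x\<close> and 1; rescaling gives the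
  tangent at any positive point.\<close>

lemma powr_le_tangent:
  fixes x a \<beta> :: real
  assumes "0 \<le> x" "0 < a" "0 \<le> \<beta>" "\<beta> \<le> 1"
  shows "x powr \<beta> \<le> a powr \<beta> * (1 - \<beta>) + a powr \<beta> * \<beta> / a * x"
proof (cases "x = 0")
  case True
  then show ?thesis using assms by simp
next
  case False
  have "(x / a) powr \<beta> * 1 powr (1 - \<beta>) \<le> \<beta> * (x / a) + (1 - \<beta>) * 1"
    using assms False by (intro Youngs_inequality_0) auto
  then have "a powr \<beta> * (x powr \<beta> / a powr \<beta>) \<le> a powr \<beta> * (\<beta> * (x / a) + (1 - \<beta>))"
    using assms by (intro mult_left_mono) (auto simp: powr_divide)
  then show ?thesis using assms by (simp add: algebra_simps)
qed

lemma sum_powr_le_uniform: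
  fixes p :: "real list"
  assumes p: "p \<in> Omega_N N" and "N \<ge> 1" "0 \<le> \<beta>" "\<beta> \<le> 1"
  shows "(\<Sum>x\<leftarrow>p. x powr \<beta>) \<le> N * (1 / N) powr \<beta>"
proof -
  define c where "c = (1 / real N) powr \<beta>"
  have "(\<Sum>x\<leftarrow>p. x powr \<beta>) \<le> (\<Sum>x\<leftarrow>p. c * (1 - \<beta>) + c * \<beta> / (1 / N) * x)"
    unfolding c_def
    using assms by (intro sum_list_mono powr_le_tangent) (auto simp: Omega_N_def)
  also have "\<dots> = N * (c * (1 - \<beta>)) + c * \<beta> / (1 / N) * sum_list p"
    using p by (simp add: sum_list_addf sum_list_const_mult sum_list_triv Omega_N_def)
  also have "\<dots> = N * c"
    using p by (simp add: Omega_N_def algebra_simps)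
  finally show ?thesis by (simp add: c_def)
qed

lemma tsallis_alt: "tsallis \<beta> p = ((\<Sum>x\<leftarrow>p. x powr \<beta>) - 1) / (1 - \<beta>)"
proof -
  have "a / b = (- a) / (- b)" for a b :: real by simp
  from this[of "1 - (\<Sum>x\<leftarrow>p. x powr \<beta>)" "\<beta> - 1"] show ?thesis by (simp add: tsallis_def)
qed

lemma entropy_continuity_tsallis:
  assumes "0 < \<beta>" and "\<beta> < 1"
  shows "entropy_continuity (tsallis \<beta>)"
  unfolding entropy_continuity_def
proof (intro conjI allI impI ballI)
  fix N :: nat
  let ?A = "{x :: nat \<Rightarrow> real. map x [0..<N] \<in> Omega_N N}"
  \<comment> \<open>Continuity of the power at a zero coordinate requires a positive exponent.\<close>
  have "continuous_on ?A (\<lambda>x. x i powr \<beta>)" if "i \<in> {0..<N}" for i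
    using that assms
    by (intro continuous_on_powr' continuous_on_const)
       (auto simp: Omega_N_def intro: continuous_on_subset[OF continuous_on_product_coordinates])
  then have "continuous_on ?A (\<lambda>x. ((\<Sum>i\<in>{0..<N}. x i powr \<beta>) - 1) / (1 - \<beta>))"
    using assms
    by (intro continuous_on_divide continuous_on_diff continuous_on_sum continuous_on_const) auto
  moreover have "tsallis \<beta> (map x [0..<N]) = ((\<Sum>i\<in>{0..<N}. x i powr \<beta>) - 1) / (1 - \<beta>)" for x
    by (simp add: tsallis_alt o_def interv_sum_list_conv_sum_set_nat)
  ultimately show "continuous_on ?A (\<lambda>x. tsallis \<beta> (map x [0..<N]))" by simp
next
  fix p assume "p \<in> Omega"
  then have "(\<Sum>x\<leftarrow>p. x powr \<beta>) = 1 \<longleftrightarrow> 1 \<in> set p"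
    using assms by (intro sum_powr_eq_1_iff) (auto simp: Omega_def Omega_N_def)
  then show "tsallis \<beta> p = 0 \<longleftrightarrow> (\<exists>k<length p. p ! k = 1)"
    using assms by (simp add: tsallis_alt in_set_conv_nth)
qed

lemma symmetric_expansibility_tsallis: "symmetric_expansibility (tsallis \<beta>)"
  unfolding symmetric_expansibility_def
proof (intro conjI allI impI ballI)
  fix p :: "real list" and \<sigma> assume "\<sigma> permutes {..<length p}"
  then have "mset (permute_list \<sigma> p) = mset p" by (rule mset_permute_list)
  then have "sum_mset (image_mset (\<lambda>x. x powr \<beta>) (mset (permute_list \<sigma> p)))
      = sum_mset (image_mset (\<lambda>x. x powr \<beta>) (mset p))" by simp
  then show "tsallis \<beta> (permute_list \<sigma> p) = tsallis \<beta> p"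
    unfolding tsallis_def mset_map[symmetric] sum_mset_sum_list by simp
qed (simp add: tsallis_def)

lemma increasing_property_tsallis:
  assumes "\<beta> < 1"
  shows "increasing_property (tsallis \<beta>)"
  unfolding increasing_property_def
proof (intro allI impI)
  fix xs ys qs :: "real list" and pn :: real
  assume Om: "xs @ pn # ys \<in> Omega" and nonneg: "\<forall>q\<in>set qs. 0 \<le> q" and pn: "pn = sum_list qs"
  define S where "S = (\<Sum>q\<leftarrow>qs. q powr \<beta>)"
  have sub: "0 \<le> S - pn powr \<beta>"
    using powr_sum_list_le[of qs \<beta>] nonneg assms by (simp add: S_def pn)
  have diff: "tsallis \<beta> (xs @ qs @ ys) - tsallis \<beta> (xs @ pn # ys) = (S - pn powr \<beta>) / (1 - \<beta>)"
    by (simp add: tsallis_alt S_def diff_divide_distrib[symmetric])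
  show "(if pn = 0 then 0 else pn * tsallis \<beta> (map (\<lambda>q. q / pn) qs))
      \<le> tsallis \<beta> (xs @ qs @ ys) - tsallis \<beta> (xs @ pn # ys)"
  proof (cases "pn = 0")
    case True
    then show ?thesis using sub assms unfolding diff by simp
  next
    case False
    have pos: "0 < pn" using False sum_list_nonneg[of qs] nonneg by (simp add: pn less_le)
    have le1: "pn \<le> 1"
      using Om member_le_sum_list_real[of "xs @ pn # ys" pn] by (auto simp: Omega_def Omega_N_def)
    have "(\<Sum>q\<leftarrow>qs. (q / pn) powr \<beta>) = (\<Sum>q\<leftarrow>qs. q powr \<beta> * (1 / pn powr \<beta>))"
      using nonneg pos by (intro arg_cong[of _ _ sum_list] map_cong) (auto simp: powr_divide)
    also have "\<dots> = S / pn powr \<beta>" by (subst sum_list_mult_const) (simp add: S_def)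
    finally have "pn * tsallis \<beta> (map (\<lambda>q. q / pn) qs)
        = pn * (S / pn powr \<beta> - 1) / (1 - \<beta>)"
      by (simp add: tsallis_alt o_def)
    also have "\<dots> = pn powr (1 - \<beta>) * ((S - pn powr \<beta>) / (1 - \<beta>))"
      using pos by (simp add: powr_diff field_simps)
    also have "\<dots> \<le> 1 * ((S - pn powr \<beta>) / (1 - \<beta>))"
      using sub assms pos le1 by (intro mult_right_mono powr_le1) auto
    finally show ?thesis using False unfolding diff by simp
  qed
qed

lemma maximum_property_tsallis:
  assumes "0 \<le> \<beta>" and "\<beta> < 1"
  shows "maximum_property (tsallis \<beta>)"
  unfolding maximum_property_def tsallis_alt
  using assms sum_powr_le_uniform
  by (auto intro!: divide_right_mono simp: sum_list_replicate)

theorem mainTheorem7: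
  fixes \<beta> :: real
  assumes "0 < \<beta>" and "\<beta> < 1"
  shows "lower_entropy (tsallis \<beta>)"
  unfolding lower_entropy_def
  using assms entropy_continuity_tsallis symmetric_expansibility_tsallis
    increasing_property_tsallis maximum_property_tsallis by simp

end
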